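(* Let $m \ge 1$ and $n \ge 1$ be integers and let $A = \{0,1,\ldots,m-1\}$. Let $P(X_1,\ldots,X_n) \in \mathbb{R}[X_1,\ldots,X_n]$ be a polynomial that sign represents the parity function over $A^n$, and suppose that the degree of $P$ in each variable $X_i$ is at most $m-1$. Then $P$ has sparsity $m^n$, and for every exponent vector $(i_1,\ldots,i_n)$ with $0 \le i_j \le m-1$, the coefficient of the monomial $\prod_{j=1}^n X_j^{i_j}$ in $P$ has sign $(-1)^{\sum_j i_j}$.
   Context: For $A \subseteq \mathbb{Z}$, the parity function $\mathrm{Par}: A^n \to \{0,1\}$ is $\mathrm{Par}(a_1,\ldots,a_n) = \sum_{i=1}^n a_i \bmod 2$. A polynomial $P \in \mathbb{R}[X_1,\ldots,X_n]$ sign represents a function $f: A^n \to \{0,1\}$ if for every $(a_1,\ldots,a_n) \in A^n$: $f(a)=0 \Rightarrow P(a) > 0$ and $f(a) = 1 \Rightarrow P(a) < 0$. The sparsity of $P$ is the number of monomials with nonzero coefficient when $P$ is written in the standard monomial basis. The degree of $P$ in $X_i$ is the largest exponent of $X_i$ among monomials with nonzero coefficient. *)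

theory Defs
  imports Complex_Main "HOL-Library.Poly_Mapping" "HOL-Library.FuncSet"
begin

text \<open>A real polynomial is a finitely supported map from exponent vectors to
  coefficients; the variables are indexed by natural numbers, and
  \<open>poly_ring n\<close> is the polynomial ring in the variables with indices \<open>1, \<dots>, n\<close>.\<close>

type_synonym rpoly = "(nat \<Rightarrow>\<^sub>0 nat) \<Rightarrow>\<^sub>0 real"

definition poly_ring :: "nat \<Rightarrow> rpoly set" where
  "poly_ring n = {P. \<forall>e \<in> Poly_Mapping.keys P. Poly_Mapping.keys e \<subseteq> {1..n}}"

definition eval_poly :: "rpoly \<Rightarrow> (nat \<Rightarrow> real) \<Rightarrow> real" where
  "eval_poly P x = (\<Sum>e \<in> Poly_Mapping.keys P. Poly_Mapping.lookup P e * (\<Prod>i \<in> Poly_Mapping.keys e. x i ^ Poly_Mapping.lookup e i))"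

definition sparsity :: "rpoly \<Rightarrow> nat" where
  "sparsity P = card (Poly_Mapping.keys P)"

text \<open>The degree of the zero polynomial is taken to be 0.\<close>

definition degree_in :: "rpoly \<Rightarrow> nat \<Rightarrow> nat" where
  "degree_in P i = Max (insert 0 ((\<lambda>e. Poly_Mapping.lookup e i) ` Poly_Mapping.keys P))"

definition parity :: "nat \<Rightarrow> (nat \<Rightarrow> int) \<Rightarrow> int" where
  "parity n a = (\<Sum>i = 1..n. a i) mod 2"

definition sign_represents :: "nat \<Rightarrow> int set \<Rightarrow> rpoly \<Rightarrow> ((nat \<Rightarrow> int) \<Rightarrow> int) \<Rightarrow> bool" where
  "sign_represents n A P f \<longleftrightarrow>
    (\<forall>a \<in> {1..n} \<rightarrow>\<^sub>E A.
      (f a = 0 \<longrightarrow> eval_poly P (\<lambda>i. real_of_int (a i)) > 0) \<and>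
      (f a = 1 \<longrightarrow> eval_poly P (\<lambda>i. real_of_int (a i)) < 0))"

end

theory Submission
  imports Defs "HOL-Computational_Algebra.Polynomial"
begin

text \<open>Lagrange interpolation expresses the coefficient of \<open>P\<close> at an exponent vector \<open>e\<close> as
  \<open>\<Sum>a. P(a) * (\<Prod>j. c (a j) (e j))\<close>, where \<open>a\<close> ranges over the grid and \<open>c k i\<close> is the
  coefficient of \<open>X^i\<close> in the univariate Lagrange polynomial of the node \<open>k\<close>. All nodes being
  nonnegative, \<open>c k i\<close> is zero or has sign \<open>(-1)^(k + i)\<close>, and \<open>c 0 i\<close> is nonzero. As \<open>P(a)\<close> has
  sign \<open>(-1)^(\<Sum>j. a j)\<close>, no two terms have opposite signs, and the term \<open>a = 0\<close> is nonzero.\<close>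

section \<open>Univariate Lagrange polynomials\<close>

text \<open>Each factor is \<open>(b - X) / (b - a)\<close> rather than
  \<open>(X - b) / (a - b)\<close>: numerators with nonnegative constant term and leading
  coefficient -1 make the alternation of signs an easy induction.\<close>

definition lagrange_basis :: "nat \<Rightarrow> nat \<Rightarrow> real poly" where
  "lagrange_basis m a = (\<Prod>b \<in> {..<m} - {a}. smult (1 / (real b - real a)) [:real b, - 1:])"

lemma degree_lagrange_basis_less:
  assumes "a < m"
  shows "degree (lagrange_basis m a) < m"
proof -
  have "degree (lagrange_basis m a)
      \<le> (\<Sum>b \<in> {..<m} - {a}. degree (smult (1 / (real b - real a)) [:real b, - 1:]))"
    unfolding lagrange_basis_def by (rule degree_prod_sum_le[unfolded o_def]) simp
  also have "\<dots> \<le> (\<Sum>b \<in> {..<m} - {a}. 1)"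
    by (intro sum_mono order_trans[OF degree_smult_le]) simp
  also have "\<dots> < m"
    using assms by simp
  finally show ?thesis .
qed

lemma poly_lagrange_basis:
  assumes "a < m" "k < m"
  shows "poly (lagrange_basis m a) (real k) = (if k = a then 1 else 0)"
proof (cases "k = a")
  case True
  then have "(\<Prod>b \<in> {..<m} - {a}. poly (smult (1 / (real b - real a)) [:real b, - 1:]) (real k)) = 1"
    by (intro prod.neutral) (auto simp: diff_divide_distrib[symmetric])
  with True show ?thesis
    by (simp add: lagrange_basis_def poly_prod)
next
  case False
  then have "\<exists>b \<in> {..<m} - {a}. poly (smult (1 / (real b - real a)) [:real b, - 1:]) (real k) = 0"
    using assms by (intro bexI[of _ k]) auto
  with False show ?thesis
    by (auto simp: lagrange_basis_def poly_prod prod_zero_iff)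
qed

text \<open>Since \<open>k < m\<close>, interpolating \<open>X^k\<close> at the \<open>m\<close>
  nodes returns \<open>X^k\<close> itself; its coefficients are then compared. So the Lagrange
  coefficients form the inverse of the Vandermonde matrix.\<close>

lemma sum_coeff_lagrange_basis_power:
  assumes "k < m"
  shows "(\<Sum>a<m. coeff (lagrange_basis m a) i * real a ^ k) = (if i = k then 1 else 0)"
proof -
  define q where "q = (\<Sum>a<m. smult (real a ^ k) (lagrange_basis m a))"
  have "q = monom 1 k"
  proof (rule poly_eqI_degree[where A = "real ` {..<m}"])
    fix x assume "x \<in> real ` {..<m}"
    then obtain l where l: "l < m" "x = real l" by auto
    have "poly q x = (\<Sum>a<m. if l = a then real a ^ k else 0)"
      unfolding q_def poly_sum l(2)
      by (intro sum.cong refl) (auto simp: poly_lagrange_basis l(1))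
    then show "poly q x = poly (monom 1 k) x"
      using l by (simp add: poly_monom)
  next
    have card: "card (real ` {..<m}) = m"
      by (simp add: card_image)
    show "degree (monom 1 k :: real poly) < card (real ` {..<m})"
      using assms by (simp add: card degree_monom_eq)
    show "degree q < card (real ` {..<m})"
      unfolding q_def card using assms
      by (intro degree_sum_less le_less_trans[OF degree_smult_le] degree_lagrange_basis_less) auto
  qed
  then have "coeff q i = coeff (monom 1 k) i" by simp
  then show ?thesis
    by (auto simp: q_def coeff_sum mult.commute split: if_splits)
qed

section \<open>Signs of the Lagrange coefficients\<close>

text \<open>Multiplying by \<open>f b - X\<close> turns the coefficient \<open>c i\<close> into
  \<open>f b * c i - c (i - 1)\<close>, and by induction neither summand has sign opposite to
  \<open>(- 1) ^ i\<close>.\<close>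

lemma alternating_coeff_prod_nonneg:
  fixes f :: "'a \<Rightarrow> real"
  assumes "finite B" "\<And>b. b \<in> B \<Longrightarrow> f b \<ge> 0"
  shows "(- 1) ^ i * coeff (\<Prod>b \<in> B. [:f b, - 1:]) i \<ge> 0"
  using assms
proof (induction B arbitrary: i rule: finite_induct)
  case empty
  then show ?case by (cases i) auto
next
  case (insert b B)
  show ?case
  proof (cases i)
    case 0
    then show ?thesis using insert insert.IH[of 0] by simp
  next
    case (Suc j)
    have "0 \<le> f b * ((- 1) ^ i * coeff (\<Prod>b \<in> B. [:f b, - 1:]) i)
        + (- 1) ^ j * coeff (\<Prod>b \<in> B. [:f b, - 1:]) j"
      using insert.prems by (intro add_nonneg_nonneg mult_nonneg_nonneg[of "f b"] insert.IH) auto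
    then show ?thesis
      using insert.hyps Suc by (simp add: algebra_simps)
  qed
qed

lemma alternating_coeff_prod_pos:
  fixes f :: "'a \<Rightarrow> real"
  assumes "finite B" "\<And>b. b \<in> B \<Longrightarrow> f b > 0" "i \<le> card B"
  shows "(- 1) ^ i * coeff (\<Prod>b \<in> B. [:f b, - 1:]) i > 0"
  using assms
proof (induction B arbitrary: i rule: finite_induct)
  case empty
  then show ?case by simp
next
  case (insert b B)
  show ?case
  proof (cases i)
    case 0
    then show ?thesis using insert insert.IH[of 0] by simp
  next
    case (Suc j)
    \<comment> \<open>Only a weak bound is possible here: for \<open>i = card B + 1\<close> this
      coefficient is 0. Strictness comes from the shifted summand with index
      \<open>j\<close>.\<close>
    have "0 \<le> f b * ((- 1) ^ i * coeff (\<Prod>b \<in> B. [:f b, - 1:]) i)"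
      using insert.hyps insert.prems less_imp_le
      by (intro mult_nonneg_nonneg[of "f b"] alternating_coeff_prod_nonneg) auto
    moreover have "0 < (- 1) ^ j * coeff (\<Prod>b \<in> B. [:f b, - 1:]) j"
      using insert Suc by (intro insert.IH) auto
    ultimately show ?thesis
      using insert.hyps Suc by (simp add: algebra_simps)
  qed
qed

text \<open>Exactly the \<open>a\<close> nodes below \<open>a\<close> contribute a negative
  factor.\<close>

lemma prod_node_differences_sign:
  assumes "a < m"
  shows "(- 1) ^ a * (\<Prod>b \<in> {..<m} - {a}. 1 / (real b - real a)) > 0"
proof -
  have "(\<Prod>b \<in> {..<m} - {a}. 1 / (real b - real a))
      = (\<Prod>b<a. 1 / (real b - real a)) * (\<Prod>b \<in> {a<..<m}. 1 / (real b - real a))"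
    using assms by (subst prod.union_disjoint[symmetric]) (auto intro!: prod.cong)
  moreover have "(\<Prod>b<a. 1 / (real b - real a)) = (\<Prod>b<a. (- 1) * (1 / (real a - real b)))"
    by (intro prod.cong) (auto simp: field_simps)
  moreover have "\<dots> = (- 1) ^ a * (\<Prod>b<a. 1 / (real a - real b))"
    by (simp only: prod.distrib) simp
  moreover have "(\<Prod>b<a. 1 / (real a - real b)) > 0" "(\<Prod>b \<in> {a<..<m}. 1 / (real b - real a)) > 0"
    by (auto intro!: prod_pos)
  ultimately show ?thesis
    by (simp add: mult.assoc[symmetric] power_add[symmetric] mult_2[symmetric])
qed

lemma lagrange_basis_eq_smult:
  "lagrange_basis m a = smult (\<Prod>b \<in> {..<m} - {a}. 1 / (real b - real a))
    (\<Prod>b \<in> {..<m} - {a}. [:real b, - 1:])"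
  unfolding lagrange_basis_def by (rule prod_smult)

text \<open>The denominators give \<open>(- 1) ^ a\<close>, the numerators \<open>(- 1) ^ i\<close>.
  The bound is not strict: for \<open>a > 0\<close> the node 0 contributes the factor
  \<open>- X\<close>, which kills the constant coefficient.\<close>

lemma coeff_lagrange_basis_sign:
  assumes "a < m"
  shows "(- 1) ^ (a + i) * coeff (lagrange_basis m a) i \<ge> 0"
proof -
  have "0 \<le> ((- 1) ^ a * (\<Prod>b \<in> {..<m} - {a}. 1 / (real b - real a)))
      * ((- 1) ^ i * coeff (\<Prod>b \<in> {..<m} - {a}. [:real b, - 1:]) i)"
    by (rule mult_nonneg_nonneg[OF less_imp_le[OF prod_node_differences_sign[OF assms]]
          alternating_coeff_prod_nonneg]) auto
  then show ?thesis
    by (simp add: lagrange_basis_eq_smult power_add mult_ac)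
qed

text \<open>The \<open>m - 1\<close> nodes other than 0 are all positive, which gives strictness up
  to index \<open>m - 1\<close>.\<close>

lemma coeff_lagrange_basis_0_sign:
  assumes "i < m"
  shows "(- 1) ^ i * coeff (lagrange_basis m 0) i > 0"
proof -
  have "0 < (\<Prod>b \<in> {..<m} - {0}. 1 / (real b - real 0))
      * ((- 1) ^ i * coeff (\<Prod>b \<in> {..<m} - {0}. [:real b, - 1:]) i)"
    using prod_node_differences_sign[of 0 m] assms
    by (intro mult_pos_pos alternating_coeff_prod_pos) auto
  then show ?thesis
    by (simp add: lagrange_basis_eq_smult mult_ac)
qed

section \<open>Interpolation on the grid\<close>

text \<open>The common index set \<open>{1..n}\<close> lets products for different exponent vectors
  be combined; the added factors have exponent 0.\<close>

lemma eval_poly_poly_ring: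
  assumes "P \<in> poly_ring n"
  shows "eval_poly P x
    = (\<Sum>d \<in> Poly_Mapping.keys P. Poly_Mapping.lookup P d * (\<Prod>j = 1..n. x j ^ Poly_Mapping.lookup d j))"
  unfolding eval_poly_def
proof (intro sum.cong refl arg_cong2[where f = "(*)"] prod.mono_neutral_left)
  fix d assume "d \<in> Poly_Mapping.keys P"
  with assms show "Poly_Mapping.keys d \<subseteq> {1..n}"
    by (auto simp: poly_ring_def)
qed (auto simp: in_keys_iff)

lemma lookup_le_degree_in:
  assumes "d \<in> Poly_Mapping.keys P"
  shows "Poly_Mapping.lookup d i \<le> degree_in P i"
  unfolding degree_in_def using assms by (intro Max_ge) auto

text \<open>Once \<open>P\<close> is expanded into monomials, the grid sum of each monomial splits
  into \<open>n\<close> univariate sums, each a Kronecker delta, so only the monomial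
  \<open>e\<close> survives.\<close>

lemma lookup_eq_sum_eval_poly_grid:
  assumes P: "P \<in> poly_ring n"
    and deg: "\<And>d j. d \<in> Poly_Mapping.keys P \<Longrightarrow> j \<in> {1..n} \<Longrightarrow> Poly_Mapping.lookup d j < m"
    and e: "Poly_Mapping.keys e \<subseteq> {1..n}"
  shows "Poly_Mapping.lookup P e
    = (\<Sum>a \<in> {1..n} \<rightarrow>\<^sub>E {..<m}. eval_poly P (\<lambda>j. real (a j))
        * (\<Prod>j = 1..n. coeff (lagrange_basis m (a j)) (Poly_Mapping.lookup e j)))"
proof -
  let ?l = "Poly_Mapping.lookup" and ?K = "Poly_Mapping.keys P"
  let ?c = "\<lambda>a i. coeff (lagrange_basis m a) i"
  have "(\<Sum>a \<in> {1..n} \<rightarrow>\<^sub>E {..<m}. eval_poly P (\<lambda>j. real (a j)) * (\<Prod>j = 1..n. ?c (a j) (?l e j)))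
      = (\<Sum>a \<in> {1..n} \<rightarrow>\<^sub>E {..<m}. \<Sum>d \<in> ?K.
          ?l P d * (\<Prod>j = 1..n. ?c (a j) (?l e j) * real (a j) ^ ?l d j))"
    unfolding eval_poly_poly_ring[OF P] sum_distrib_right prod.distrib
    by (intro sum.cong refl) (simp add: mult_ac)
  also have "\<dots> = (\<Sum>d \<in> ?K. ?l P d
      * (\<Sum>a \<in> {1..n} \<rightarrow>\<^sub>E {..<m}. \<Prod>j = 1..n. ?c (a j) (?l e j) * real (a j) ^ ?l d j))"
    by (subst sum.swap) (simp add: sum_distrib_left)
  also have "\<dots> = (\<Sum>d \<in> ?K. ?l P d * (\<Prod>j = 1..n. \<Sum>a<m. ?c a (?l e j) * real a ^ ?l d j))"
    by (subst prod_sum_PiE) auto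
  \<comment> \<open>The degree bound enters here: univariate interpolation reproduces a power only
    if its exponent \<open>?l d j\<close> is below \<open>m\<close>.\<close>
  also have "\<dots> = (\<Sum>d \<in> ?K. ?l P d * (\<Prod>j = 1..n. if ?l e j = ?l d j then 1 else 0))"
    by (intro sum.cong refl arg_cong2[where f = "(*)"] prod.cong sum_coeff_lagrange_basis_power deg)
  also have "\<dots> = (\<Sum>d \<in> ?K. if d = e then ?l P d else 0)"
  proof (intro sum.cong refl)
    fix d assume "d \<in> ?K"
    then have d: "Poly_Mapping.keys d \<subseteq> {1..n}"
      using P by (auto simp: poly_ring_def)
    have "(\<forall>j \<in> {1..n}. ?l e j = ?l d j) \<longleftrightarrow> d = e"
    proof
      assume *: "\<forall>j \<in> {1..n}. ?l e j = ?l d j"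
      have "?l d j = ?l e j" for j
      proof (cases "j \<in> {1..n}")
        case True
        with * show ?thesis by metis
      next
        case False
        with d e have "j \<notin> Poly_Mapping.keys d" "j \<notin> Poly_Mapping.keys e" by blast+
        then show ?thesis by (simp add: in_keys_iff)
      qed
      then show "d = e" by (rule poly_mapping_eqI)
    qed auto
    moreover have "(\<Prod>j = 1..n. if ?l e j = ?l d j then 1 else 0)
        = (if \<forall>j \<in> {1..n}. ?l e j = ?l d j then 1 else 0 :: real)"
      by simp
    ultimately show "?l P d * (\<Prod>j = 1..n. if ?l e j = ?l d j then 1 else 0)
        = (if d = e then ?l P d else 0)"
      by simp
  qed
  \<comment> \<open>For \<open>e\<close> outside the support no summand matches, and
    \<open>?l P e\<close> is 0 as well.\<close>
  also have "\<dots> = ?l P e"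
    by (auto simp: in_keys_iff)
  finally show ?thesis by simp
qed

section \<open>Signs of the coefficients of \<open>P\<close>\<close>

lemma sign_represents_parity_grid:
  assumes P: "P \<in> poly_ring n"
    and sign: "sign_represents n {0..int m - 1} P (parity n)"
    and a: "a \<in> {1..n} \<rightarrow>\<^sub>E {..<m}"
  shows "(- 1) ^ (\<Sum>j = 1..n. a j) * eval_poly P (\<lambda>j. real (a j)) > 0"
proof -
  \<comment> \<open>The restriction makes \<open>b\<close> extensional: outside
    \<open>{1..n}\<close> the value \<open>int (a j)\<close> need not be the
    \<open>undefined\<close> of type \<open>int\<close>. Evaluation of \<open>P\<close> ignores
    these values.\<close>
  define b where "b = (\<lambda>j \<in> {1..n}. int (a j))"
  have "b \<in> {1..n} \<rightarrow>\<^sub>E {0..int m - 1}"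
    using a by (force simp: b_def PiE_iff)
  moreover have "eval_poly P (\<lambda>j. real_of_int (b j)) = eval_poly P (\<lambda>j. real (a j))"
    unfolding eval_poly_poly_ring[OF P] by (intro sum.cong refl) (simp add: b_def)
  moreover have "parity n b = int (\<Sum>j = 1..n. a j) mod 2"
    by (simp add: parity_def b_def)
  ultimately have *:
    "int (\<Sum>j = 1..n. a j) mod 2 = 0 \<longrightarrow> eval_poly P (\<lambda>j. real (a j)) > 0"
    "int (\<Sum>j = 1..n. a j) mod 2 = 1 \<longrightarrow> eval_poly P (\<lambda>j. real (a j)) < 0"
    using sign unfolding sign_represents_def by metis+
  show ?thesis
  proof (cases "even (\<Sum>j = 1..n. a j)")
    case True
    then have "int (\<Sum>j = 1..n. a j) mod 2 = 0" by presburger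
    with * True show ?thesis by simp
  next
    case False
    then have "int (\<Sum>j = 1..n. a j) mod 2 = 1" by presburger
    with * False show ?thesis by simp
  qed
qed

lemma lookup_sign:
  assumes P: "P \<in> poly_ring n"
    and sign: "sign_represents n {0..int m - 1} P (parity n)"
    and deg: "\<And>d j. d \<in> Poly_Mapping.keys P \<Longrightarrow> j \<in> {1..n} \<Longrightarrow> Poly_Mapping.lookup d j < m"
    and e: "Poly_Mapping.keys e \<subseteq> {1..n}" "\<And>j. j \<in> {1..n} \<Longrightarrow> Poly_Mapping.lookup e j < m"
  shows "(- 1) ^ (\<Sum>j = 1..n. Poly_Mapping.lookup e j) * Poly_Mapping.lookup P e > 0"
proof -
  let ?l = "Poly_Mapping.lookup"
  let ?G = "{1..n} \<rightarrow>\<^sub>E {..<m}"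
  \<comment> \<open>The sign \<open>(- 1) ^ (\<Sum>j = 1..n. a j)\<close> is inserted twice, once
    beside the value of \<open>P\<close> and once spread over the product; its square is 1.\<close>
  define t where "t a = ((- 1) ^ (\<Sum>j = 1..n. a j) * eval_poly P (\<lambda>j. real (a j)))
    * (\<Prod>j = 1..n. (- 1) ^ (a j + ?l e j) * coeff (lagrange_basis m (a j)) (?l e j))"
    for a :: "nat \<Rightarrow> nat"
  have lookup: "?l P e = (\<Sum>a \<in> ?G. eval_poly P (\<lambda>j. real (a j))
      * (\<Prod>j = 1..n. coeff (lagrange_basis m (a j)) (?l e j)))"
    using P deg e(1) by (rule lookup_eq_sum_eval_poly_grid)
  have "(- 1) ^ (\<Sum>j = 1..n. ?l e j) * ?l P e = sum t ?G"
    unfolding lookup sum_distrib_left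
  proof (intro sum.cong refl)
    fix a :: "nat \<Rightarrow> nat"
    have "(- 1) ^ (\<Sum>j = 1..n. a j) * (- 1) ^ (\<Sum>j = 1..n. a j) = (1 :: real)"
      by (simp flip: power_add mult_2)
    moreover have "s * (v * c) = s' * v * (s' * s * c)" if "s' * s' = 1" for s v c s' :: real
      using that by algebra
    ultimately show "(- 1) ^ (\<Sum>j = 1..n. ?l e j) * (eval_poly P (\<lambda>j. real (a j))
        * (\<Prod>j = 1..n. coeff (lagrange_basis m (a j)) (?l e j))) = t a"
      unfolding t_def prod.distrib power_add power_sum[symmetric] by blast
  qed
  moreover have "sum t ?G > 0"
  proof (rule sum_pos2)
    show "finite ?G" by (intro finite_PiE) auto
    \<comment> \<open>For \<open>n = 0\<close> the grid consists of the empty function alone,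
      whatever \<open>m\<close> is.\<close>
    have "m > 0" if "n > 0" using e(2)[of 1] that by simp
    then show z: "(\<lambda>j \<in> {1..n}. 0) \<in> ?G" by auto
    \<comment> \<open>At the origin every factor belongs to the node 0, where the coefficient bound
      is strict.\<close>
    show "0 < t (\<lambda>j \<in> {1..n}. 0)"
      unfolding t_def
      by (rule mult_pos_pos[OF sign_represents_parity_grid[OF P sign z]], rule prod_pos)
        (simp add: coeff_lagrange_basis_0_sign e(2))
    show "0 \<le> t a" if "a \<in> ?G" for a
      unfolding t_def using that
      by (intro mult_nonneg_nonneg[OF less_imp_le[OF sign_represents_parity_grid[OF P sign that]]]
          prod_nonneg coeff_lagrange_basis_sign) auto
  qed
  ultimately show ?thesis by simp
qed

section \<open>Counting exponent vectors and conclusion\<close>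

lemma card_bounded_exponents:
  "card {e :: nat \<Rightarrow>\<^sub>0 nat. Poly_Mapping.keys e \<subseteq> {1..n} \<and> (\<forall>j \<in> {1..n}. Poly_Mapping.lookup e j < m)}
    = m ^ n" (is "card ?E = _")
proof -
  have "bij_betw (\<lambda>e. restrict (Poly_Mapping.lookup e) {1..n}) ?E ({1..n} \<rightarrow>\<^sub>E {..<m})"
  \<comment> \<open>The inverse extends a grid function by 0 outside \<open>{1..n}\<close>, which
    has finite support.\<close>
  proof (rule bij_betw_byWitness[where f' = "\<lambda>f. Abs_poly_mapping (\<lambda>j. f j when j \<in> {1..n})"])
    have lookup: "Poly_Mapping.lookup (Abs_poly_mapping (\<lambda>j. f j when j \<in> {1..n}))
        = (\<lambda>j. f j when j \<in> {1..n})" for f :: "nat \<Rightarrow> nat"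
      by (rule lookup_Abs_poly_mapping) (rule finite_subset[of _ "{1..n}"], auto simp: when_def split: if_splits)
    show "\<forall>e \<in> ?E. Abs_poly_mapping (\<lambda>j. restrict (Poly_Mapping.lookup e) {1..n} j when j \<in> {1..n}) = e"
      by (auto intro!: poly_mapping_eqI simp: lookup when_def in_keys_iff subset_iff)
    show "\<forall>f \<in> {1..n} \<rightarrow>\<^sub>E {..<m}.
        restrict (Poly_Mapping.lookup (Abs_poly_mapping (\<lambda>j. f j when j \<in> {1..n}))) {1..n} = f"
      unfolding lookup by (auto simp: fun_eq_iff PiE_iff extensional_def)
    show "(\<lambda>e. restrict (Poly_Mapping.lookup e) {1..n}) ` ?E \<subseteq> {1..n} \<rightarrow>\<^sub>E {..<m}"
      by auto
    show "(\<lambda>f. Abs_poly_mapping (\<lambda>j. f j when j \<in> {1..n})) ` ({1..n} \<rightarrow>\<^sub>E {..<m}) \<subseteq> ?E"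
      by (auto simp: lookup in_keys_iff when_def split: if_splits)
  qed
  then show ?thesis
    by (simp add: bij_betw_same_card card_PiE)
qed

theorem theorem3p5:
  fixes m n :: nat and A :: "int set" and P :: rpoly
  assumes "m \<ge> 1" and "n \<ge> 1"
    and "A = {0..int m - 1}"
    and "P \<in> poly_ring n"
    and "sign_represents n A P (parity n)"
    and "\<And>i. i \<in> {1..n} \<Longrightarrow> degree_in P i \<le> m - 1"
  shows "sparsity P = m ^ n \<and>
    (\<forall>e. Poly_Mapping.keys e \<subseteq> {1..n} \<and> (\<forall>j \<in> {1..n}. Poly_Mapping.lookup e j \<le> m - 1) \<longrightarrow>
      sgn (Poly_Mapping.lookup P e) = (- 1) ^ (\<Sum>j = 1..n. Poly_Mapping.lookup e j))"
proof -
  let ?l = "Poly_Mapping.lookup"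
  let ?E = "{e. Poly_Mapping.keys e \<subseteq> {1..n} \<and> (\<forall>j \<in> {1..n}. ?l e j < m)}"
  have le: "k \<le> m - 1 \<longleftrightarrow> k < m" for k
    using assms(1) by auto
  have deg: "?l d j < m" if "d \<in> Poly_Mapping.keys P" "j \<in> {1..n}" for d j
    using lookup_le_degree_in[OF that(1)] assms(6)[OF that(2)] le le_trans by blast
  have pos: "(- 1) ^ (\<Sum>j = 1..n. ?l e j) * ?l P e > 0" if "e \<in> ?E" for e
    using that assms(3-5) deg by (intro lookup_sign) auto
  \<comment> \<open>The degree bounds confine the support to \<open>?E\<close>; strict positivity in
    \<open>pos\<close> forces every vector of \<open>?E\<close> into it.\<close>
  have "Poly_Mapping.keys P = ?E"
  proof
    show "Poly_Mapping.keys P \<subseteq> ?E"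
      using assms(4) deg by (auto simp: poly_ring_def)
    show "?E \<subseteq> Poly_Mapping.keys P"
    proof
      fix e assume "e \<in> ?E"
      from pos[OF this] have "?l P e \<noteq> 0" by auto
      then show "e \<in> Poly_Mapping.keys P" by (simp add: in_keys_iff)
    qed
  qed
  then have "sparsity P = m ^ n"
    unfolding sparsity_def using card_bounded_exponents by simp
  moreover have "sgn (?l P e) = (- 1) ^ (\<Sum>j = 1..n. ?l e j)" if "e \<in> ?E" for e
    using pos[OF that] by (cases "even (\<Sum>j = 1..n. ?l e j)") simp_all
  ultimately show ?thesis
    unfolding le by blast
qed

end
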